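(* All Runge–Kutta methods are globally conservative: let $\hat{\mathbf f}:\mathbb R^m\to\mathbb R^m$ be a globally conservative discretization with cell volumes $|\Omega_1|,\dots,|\Omega_m|$, let $a_{j,l},b_j\in\mathbb R$ ($1\le j,l\le s$), and suppose $\mathbf u^n,\mathbf u^{n+1},\mathbf k_1,\dots,\mathbf k_s\in\mathbb R^m$ satisfy $$\mathbf u^{n+1}=\mathbf u^n+\Delta t\sum_{j=1}^s b_j\mathbf k_j,\qquad \mathbf k_j=\hat{\mathbf f}\left(\mathbf u^n+\Delta t\sum_{l=1}^s a_{j,l}\mathbf k_l\right),\quad j=1,\dots,s.$$ Then $$\sum_{i=1}^m|\Omega_i|u_i^{n+1}=\sum_{i=1}^m|\Omega_i|u_i^n.$$
   Context: $\hat{\mathbf f}=(\hat f_1,\dots,\hat f_m)^\top$ is the right-hand side of a semidiscretization $\mathbf u_t=\hat{\mathbf f}(\mathbf u)$ on a mesh with cells $\Omega_i$ of volume $|\Omega_i|>0$. It is called globally conservative if $\sum_{i=1}^m|\Omega_i|\hat f_i(\mathbf u)=0$ for all $\mathbf u\in\mathbb R^m$. A time integration method is globally conservative if $\sum_i|\Omega_i|u_i^{n+1}=\sum_i|\Omega_i|u_i^n$ in every time step. Here $\Delta t>0$. *)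

theory Defs
  imports "HOL-Analysis.Analysis"
begin

(* The index type 'm enumerates the mesh cells; vol i is the cell volume |Omega_i|. *)
definition globally_conservative :: "('m::finite \<Rightarrow> real) \<Rightarrow> (real ^ 'm \<Rightarrow> real ^ 'm) \<Rightarrow> bool" where
  "globally_conservative vol f \<longleftrightarrow> (\<forall>u. (\<Sum>i\<in>UNIV. vol i * f u $ i) = 0)"

end

theory Submission
  imports Defs
begin

text \<open>
  Total mass \<open>u \<mapsto> \<Sum>i. vol i * u $ i\<close> is the inner product with the vector of cell volumes, hence a
  linear functional. Global conservation says that this functional vanishes on the range of \<open>f\<close>.
  Every Runge--Kutta stage \<open>k j\<close> lies in that range, whatever its argument, and the update adds a
  linear combination of the stages, so the total mass does not change. The argument
  covers explicit and implicit methods alike.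
\<close>

lemma total_mass_eq_inner:
  fixes vol :: "'m::finite \<Rightarrow> real"
  shows "(\<Sum>i\<in>UNIV. vol i * u $ i) = (\<chi> i. vol i) \<bullet> u"
  by (simp add: inner_vec_def)

theorem mainTheorem4:
  fixes f :: "real ^ 'm \<Rightarrow> real ^ 'm"
    and vol :: "'m::finite \<Rightarrow> real"
    and s :: nat
    and a :: "nat \<Rightarrow> nat \<Rightarrow> real"
    and b :: "nat \<Rightarrow> real"
    and dt :: real
    and u_old u_new :: "real ^ 'm"
    and k :: "nat \<Rightarrow> real ^ 'm"
  assumes "\<And>i. vol i > 0"
    and "globally_conservative vol f"
    and "dt > 0"
    and "u_new = u_old + dt *\<^sub>R (\<Sum>j=1..s. b j *\<^sub>R k j)"
    and "\<And>j. j \<in> {1..s} \<Longrightarrow> k j = f (u_old + dt *\<^sub>R (\<Sum>l=1..s. a j l *\<^sub>R k l))"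
  shows "(\<Sum>i\<in>UNIV. vol i * u_new $ i) = (\<Sum>i\<in>UNIV. vol i * u_old $ i)"
proof -
  let ?w = "(\<chi> i. vol i) :: real ^ 'm"
  have stage: "?w \<bullet> k j = 0" if "j \<in> {1..s}" for j
  proof -
    have "?w \<bullet> f v = 0" for v
      using assms(2) by (simp add: globally_conservative_def total_mass_eq_inner)
    then show ?thesis
      by (subst assms(5)[OF that])
  qed
  have "?w \<bullet> u_new = ?w \<bullet> u_old + dt * (\<Sum>j=1..s. b j * (?w \<bullet> k j))"
    by (simp add: assms(4) inner_add_right inner_sum_right)
  also have "\<dots> = ?w \<bullet> u_old"
    using stage by simp
  finally show ?thesis
    by (simp only: total_mass_eq_inner)
qed

end
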